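(* For all $\xi\in\mathbb C^2\setminus\{(0,0)\}$, $$1\le \frac{\|\xi\|_{H^1_*}}{\|\xi\|_{H^4}}\le 1.01.$$
   Context: For $(a_1,a_2)\in\mathbb C^2$ and $0<p<\infty$ the Hardy quasinorm is $\|(a_1,a_2)\|_{H^p}=\left(\frac1{2\pi}\int_0^{2\pi}|a_1+a_2e^{it}|^p\,dt\right)^{1/p}$. The norm dual to $H^1$ on $\mathbb C^2$ is $\|\xi\|_{H^1_*}=\sup\{|\langle\xi,\eta\rangle| : \eta\in\mathbb C^2,\ \|\eta\|_{H^1}\le 1\}$, where $\langle\xi,\eta\rangle=\xi_1\overline{\eta_1}+\xi_2\overline{\eta_2}$. *)

theory Defs
  imports "HOL-Analysis.Analysis"
begin

text \<open>Only \<open>p > 0\<close> is meaningful. The integrand is then continuous in \<open>t\<close>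
  (recall \<open>0 powr p = 0\<close>), so the integral exists.\<close>

definition hardy_norm :: "real \<Rightarrow> complex \<times> complex \<Rightarrow> real" where
  "hardy_norm p a =
     (1 / (2 * pi) *
       integral {0..2 * pi} (\<lambda>t. cmod (fst a + snd a * exp (\<i> * complex_of_real t)) powr p))
     powr (1 / p)"

text \<open>The complex (sesquilinear) pairing, as opposed to the real-valued \<open>\<bullet>\<close> on the product type.\<close>

definition cpairing :: "complex \<times> complex \<Rightarrow> complex \<times> complex \<Rightarrow> complex" where
  "cpairing \<xi> \<eta> = fst \<xi> * cnj (fst \<eta>) + snd \<xi> * cnj (snd \<eta>)"

text \<open>The set is nonempty and bounded above (each coefficient of \<open>\<eta>\<close> is at most
  \<open>hardy_norm 1 \<eta>\<close> in modulus), so the real supremum is the usual one.\<close>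

definition hardy_dual_norm :: "complex \<times> complex \<Rightarrow> real" where
  "hardy_dual_norm \<xi> = Sup {cmod (cpairing \<xi> \<eta>) |\<eta>. hardy_norm 1 \<eta> \<le> 1}"

end

theory Submission
  imports Defs "HOL-Computational_Algebra.Polynomial"
begin

text \<open>
  By Parseval, \<open>\<parallel>(a, b)\<parallel>\<close> in \<open>H\<^sup>4\<close> is the fourth root of
  \<open>\<bar>a\<bar>\<^sup>4 + 4\<bar>a\<bar>\<^sup>2\<bar>b\<bar>\<^sup>2 + \<bar>b\<bar>\<^sup>4\<close>, and the \<open>H\<^sup>1\<close> norm of \<open>(1, z)\<close> with \<open>\<bar>z\<bar> \<le> 1\<close> is the squared
  \<open>L\<^sup>2\<close> norm of the square root of \<open>1 + z e\<^sup>i\<^sup>t\<close>, that is, the sum of the squares of the binomial coefficients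
  of \<open>1/2\<close> against the powers of \<open>X = \<bar>z\<bar>\<^sup>2\<close>. Hence this norm lies between \<open>1 + X/4 + X\<^sup>2/64\<close> and
  \<open>1 + X/4 + X\<^sup>2/64 + X\<^sup>3/128\<close>.

  For \<open>f = a + b e\<^sup>i\<^sup>t\<close>, the functional norming \<open>(a, b)\<close> in \<open>H\<^sup>4\<close> is, up to a factor, the projection
  \<open>\<eta> = (a(\<bar>a\<bar>\<^sup>2 + 2\<bar>b\<bar>\<^sup>2), b(2\<bar>a\<bar>\<^sup>2 + \<bar>b\<bar>\<^sup>2))\<close> of \<open>\<bar>f\<bar>\<^sup>2 f\<close>. Testing the dual norm with this \<open>\<eta>\<close> gives the
  lower bound. For the upper bound every \<open>(1, x)\<close> with \<open>0 \<le> x \<le> 1\<close> is, up to a factor, such an \<open>\<eta>\<close> with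
  \<open>f = 1 + y e\<^sup>i\<^sup>t\<close>, and Hoelder's inequality applies. With \<open>w = y\<^sup>2\<close>, both bounds become the comparison of
  \<open>(1 + 4w + w\<^sup>2)\<^sup>3\<close> with the fourth power of \<open>(1 + 2w)\<close> times a polynomial in \<open>X = w(2 + w)\<^sup>2/(1 + 2w)\<^sup>2\<close>.
\<close>

section \<open>Parseval's identity on the circle\<close>

lemma integral_exp_int:
  fixes k :: int
  shows "((\<lambda>t. exp (\<i> * of_int k * complex_of_real t)) has_integral (if k = 0 then 2 * pi else 0)) {0..2 * pi}"
proof (cases "k = 0")
  case True
  thus ?thesis using has_integral_const_real[of "1::complex" 0 "2 * pi"] by (simp add: scaleR_conv_of_real)
next
  case False
  let ?F = "\<lambda>t. exp (\<i> * of_int k * complex_of_real t) / (\<i> * of_int k)"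
  have "((\<lambda>t. exp (\<i> * of_int k * complex_of_real t)) has_integral (?F (2 * pi) - ?F 0)) {0..2 * pi}"
    using False
    by (intro fundamental_theorem_of_calculus)
       (auto intro!: derivative_eq_intros has_vector_derivative_real_field simp: field_simps)
  moreover have "exp (\<i> * of_int k * complex_of_real (2 * pi)) = 1"
    using exp_integer_2pi[of "of_int k"] by (simp add: mult_ac)
  ultimately show ?thesis using False by simp
qed

lemma parseval_sum:
  fixes c :: "nat \<Rightarrow> complex"
  shows "((\<lambda>t. (cmod (\<Sum>n<N. c n * exp (\<i> * complex_of_real t) ^ n))\<^sup>2) has_integral
    2 * pi * (\<Sum>n<N. (cmod (c n))\<^sup>2)) {0..2 * pi}"
proof -
  let ?e = "\<lambda>n t. exp (\<i> * complex_of_real t) ^ n"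
  \<comment> \<open>Writing the squared modulus as a product with the conjugate gives a double sum
    of exponentials; integration keeps only the diagonal.\<close>
  have eq: "complex_of_real ((cmod (\<Sum>n<N. c n * ?e n t))\<^sup>2) =
      (\<Sum>m<N. \<Sum>n<N. c m * cnj (c n) * exp (\<i> * of_int (int m - int n) * complex_of_real t))" for t
  proof -
    have "?e m t * cnj (?e n t) = exp (\<i> * of_int (int m - int n) * complex_of_real t)" for m n
      by (simp add: exp_cnj algebra_simps flip: exp_of_nat_mult exp_add exp_diff)
    thus ?thesis
      unfolding complex_norm_square by (simp add: sum_product mult_ac)
  qed
  have "((\<lambda>t. complex_of_real ((cmod (\<Sum>n<N. c n * ?e n t))\<^sup>2)) has_integral
      (\<Sum>m<N. \<Sum>n<N. c m * cnj (c n) * (if int m - int n = 0 then 2 * pi else 0))) {0..2 * pi}"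
    unfolding eq by (intro has_integral_sum has_integral_mult_right integral_exp_int) auto
  also have "(\<Sum>m<N. \<Sum>n<N. c m * cnj (c n) * (if int m - int n = 0 then 2 * pi else 0)) =
      complex_of_real (2 * pi * (\<Sum>n<N. (cmod (c n))\<^sup>2))"
  proof -
    have "(\<Sum>n<N. c m * cnj (c n) * (if int m - int n = 0 then 2 * pi else 0)) =
        complex_of_real (2 * pi * (cmod (c m))\<^sup>2)" if "m < N" for m
      using that complex_norm_square[of "c m"]
      by (simp add: if_distrib[of "\<lambda>x. _ * complex_of_real x"] mult_ac cong: if_cong)
    thus ?thesis by (simp add: sum_distrib_left)
  qed
  finally have "((\<lambda>t. complex_of_real ((cmod (\<Sum>n<N. c n * ?e n t))\<^sup>2)) has_integral
      complex_of_real (2 * pi * (\<Sum>n<N. (cmod (c n))\<^sup>2))) {0..2 * pi}" .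
  from has_integral_Re[OF this] show ?thesis
    by (simp only: Re_complex_of_real)
qed

text \<open>Dominated convergence carries the finite identity to the limit: absolute summability
  bounds all partial sums uniformly in \<open>t\<close>.\<close>

lemma parseval_sums:
  fixes c :: "nat \<Rightarrow> complex" and h :: "real \<Rightarrow> complex"
  assumes summable: "summable (\<lambda>n. cmod (c n))"
    and h: "\<And>t. (\<lambda>n. c n * exp (\<i> * complex_of_real t) ^ n) sums h t"
  shows "(\<lambda>n. (cmod (c n))\<^sup>2) sums (1 / (2 * pi) * integral {0..2 * pi} (\<lambda>t. (cmod (h t))\<^sup>2))"
proof -
  let ?S = "\<lambda>N t. \<Sum>n<N. c n * exp (\<i> * complex_of_real t) ^ n"
  let ?C = "\<Sum>n. cmod (c n)"
  have "(\<lambda>N. integral {0..2 * pi} (\<lambda>t. (cmod (?S N t))\<^sup>2)) \<longlonglongrightarrow> integral {0..2 * pi} (\<lambda>t. (cmod (h t))\<^sup>2)"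
  proof (rule dominated_convergence(2)[where h = "\<lambda>t. ?C\<^sup>2"])
    fix N and t :: real
    have "cmod (?S N t) \<le> (\<Sum>n<N. cmod (c n * exp (\<i> * complex_of_real t) ^ n))" by (rule norm_sum)
    also have "\<dots> = (\<Sum>n<N. cmod (c n))" by (simp add: norm_mult norm_power)
    also have "\<dots> \<le> ?C" using summable by (intro sum_le_suminf) auto
    finally show "norm ((cmod (?S N t))\<^sup>2) \<le> ?C\<^sup>2" by (simp add: power_mono)
  next
    show "(\<lambda>N. (cmod (?S N t))\<^sup>2) \<longlonglongrightarrow> (cmod (h t))\<^sup>2" for t
      using h[of t] unfolding sums_def by (intro tendsto_intros)
  qed (use parseval_sum in \<open>auto simp: integrable_on_def\<close>)
  hence "(\<lambda>N. 2 * pi * (\<Sum>n<N. (cmod (c n))\<^sup>2)) \<longlonglongrightarrow> integral {0..2 * pi} (\<lambda>t. (cmod (h t))\<^sup>2)"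
    by (simp only: integral_unique[OF parseval_sum])
  from tendsto_mult[OF tendsto_const[of "1 / (2 * pi)"] this] show ?thesis
    unfolding sums_def by simp
qed

section \<open>Binomial series and bounds for the \<open>H^1\<close> norm\<close>

definition circle_mean_norm :: "complex \<Rightarrow> real" where
  "circle_mean_norm z = 1 / (2 * pi) * integral {0..2 * pi} (\<lambda>t. cmod (1 + z * exp (\<i> * complex_of_real t)))"

text \<open>The integrand is the squared modulus of the principal square root of
  \<open>1 + z e^{it}\<close>. For \<open>cmod z < 1\<close> its binomial series converges
  absolutely, so Parseval applies.\<close>

lemma circle_mean_norm_sums:
  assumes "cmod z < 1"
  shows "(\<lambda>n. (((1 / 2 :: real) gchoose n) ^ 2) * (cmod z)\<^sup>2 ^ n) sums circle_mean_norm z"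
proof -
  let ?c = "\<lambda>n. ((1 / 2) gchoose n) * z ^ n"
  let ?h = "\<lambda>t. (1 + z * exp (\<i> * complex_of_real t)) powr (1 / 2)"
  have "summable (\<lambda>n. cmod (?c n))"
  proof (rule abs_summable_in_conv_radius)
    show "ereal (norm z) < conv_radius (\<lambda>n. (1 / 2 :: complex) gchoose n)"
      using assms conv_radius_gchoose[of "1 / 2 :: complex"] by (auto simp: one_ereal_def)
  qed
  moreover have "(\<lambda>n. ?c n * exp (\<i> * complex_of_real t) ^ n) sums ?h t" for t
    using gen_binomial_complex[of "z * exp (\<i> * complex_of_real t)" "1 / 2"] assms
    by (simp add: norm_mult power_mult_distrib mult_ac)
  ultimately have "(\<lambda>n. (cmod (?c n))\<^sup>2) sums (1 / (2 * pi) * integral {0..2 * pi} (\<lambda>t. (cmod (?h t))\<^sup>2))"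
    by (rule parseval_sums)
  moreover have "(cmod (?h t))\<^sup>2 = cmod (1 + z * exp (\<i> * complex_of_real t))" for t
    by (simp add: norm_powr_real_powr' powr_half_sqrt)
  moreover have "cmod (?c n) = \<bar>(1 / 2 :: real) gchoose n\<bar> * cmod z ^ n" for n
  proof -
    have "((1 / 2 :: complex) gchoose n) = complex_of_real ((1 / 2) gchoose n)"
      by (simp add: gbinomial_prod_rev)
    thus ?thesis by (simp only: norm_mult norm_power norm_of_real)
  qed
  ultimately show ?thesis
    by (simp add: circle_mean_norm_def power_mult_distrib power_mult[symmetric] mult.commute)
qed

lemma gbinomial_half_square_Suc:
  "((1 / 2 :: real) gchoose Suc n)\<^sup>2 = ((1 / 2) gchoose n)\<^sup>2 * ((2 * real n - 1) / (2 * real n + 2))\<^sup>2"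
proof -
  have "(1 / 2 :: real) gchoose Suc n = ((1 / 2) gchoose n) * ((1 / 2 - real n) / (real n + 1))"
    using gbinomial_absorption'[of "Suc n" "1/2::real"] gbinomial_mult_1[of "1/2::real" n] by (simp add: field_simps)
  also have "(1 / 2 - real n) / (real n + 1) = - ((2 * real n - 1) / (2 * real n + 2))"
    by (simp add: field_simps)
  finally show ?thesis by (simp add: power_mult_distrib power_divide)
qed

text \<open>The right-hand side telescopes: with \<open>c\<^sub>n\<close> the squared coefficient,
  \<open>c\<^sub>n \<le> (n + 1) c\<^sub>n / 2 - (n + 2) c\<^sub>n\<^sub>+\<^sub>1 / 2\<close> for \<open>n \<ge> 2\<close>.\<close>

lemma sum_gbinomial_half_square_le:
  "(\<Sum>n<N. ((1 / 2 :: real) gchoose (n + 3))\<^sup>2) \<le> 1 / 128 - (real N + 4) / 2 * ((1 / 2) gchoose (N + 3))\<^sup>2"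
proof (induction N)
  case 0
  \<comment> \<open>This value makes the right-hand side exactly 0, so the base case is an equality;
    it fixes the constant \<open>1 / 128\<close>.\<close>
  have "((1 / 2 :: real) gchoose 3)\<^sup>2 = 1 / 256"
    by (simp add: numeral_3_eq_3 gbinomial_half_square_Suc power_divide)
  thus ?case by simp
next
  case (Suc N)
  define b where "b = ((1 / 2 :: real) gchoose (N + 3))\<^sup>2"
  have 1: "(1 / 2 gchoose (Suc N + 3))\<^sup>2 = b * ((2 * real N + 5) / (2 * real N + 8))\<^sup>2"
    using gbinomial_half_square_Suc[of "N + 3"] by (simp add: b_def add_ac)
  \<comment> \<open>Once denominators are cleared, the two sides differ by
    \<open>3 * N + 3\<close>.\<close>
  have "(real N + 5) / 2 * ((2 * real N + 5) / (2 * real N + 8))\<^sup>2 \<le> (real N + 4) / 2 - 1"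
    by (simp add: divide_simps power2_eq_square) (simp add: algebra_simps)
  hence "b * ((real N + 5) / 2 * ((2 * real N + 5) / (2 * real N + 8))\<^sup>2) \<le> b * ((real N + 4) / 2 - 1)"
    by (intro mult_left_mono) (simp_all add: b_def)
  also have "\<dots> = (real N + 4) / 2 * b - b" by (simp add: algebra_simps)
  finally have "(real N + 5) / 2 * (1 / 2 gchoose (Suc N + 3))\<^sup>2 \<le> (real N + 4) / 2 * b - b"
    unfolding 1 by (simp add: mult_ac)
  with Suc show ?case
    by (simp add: b_def add_ac)
qed

text \<open>The first three terms are kept exactly. The others are nonnegative, and
  \<open>X ^ n \<le> X ^ 3\<close> reduces them to the tail sum bounded by
  \<open>1 / 128\<close>.\<close>

lemma circle_mean_norm_bounds_open_disc:
  assumes "cmod z < 1"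
  shows "1 + (cmod z)\<^sup>2 / 4 + (cmod z) ^ 4 / 64 \<le> circle_mean_norm z"
    and "circle_mean_norm z \<le> 1 + (cmod z)\<^sup>2 / 4 + (cmod z) ^ 4 / 64 + (cmod z) ^ 6 / 128"
proof -
  define b where "b n = ((1 / 2 :: real) gchoose n)\<^sup>2" for n
  define X where "X = (cmod z)\<^sup>2"
  have X: "0 \<le> X" "X \<le> 1" using assms by (auto simp: X_def power_le_one)
  have b0: "b n \<ge> 0" for n by (simp add: b_def)
  have b_Suc: "b (Suc n) = b n * ((2 * real n - 1) / (2 * real n + 2))\<^sup>2" for n
    unfolding b_def by (rule gbinomial_half_square_Suc)
  have "b 0 = 1" by (simp add: b_def)
  moreover from this have "b 1 = 1 / 4" using b_Suc[of 0] by (simp add: power_divide)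
  moreover from this have "b 2 = 1 / 64" using b_Suc[of 1] by (simp add: power_divide flip: numeral_2_eq_2)
  moreover have "(\<Sum>n<3. b n * X ^ n) = b 0 + b 1 * X + b 2 * X\<^sup>2"
    by (simp add: eval_nat_numeral)
  ultimately have "(\<Sum>n<3. b n * X ^ n) = 1 + 1 / 4 * X + 1 / 64 * X\<^sup>2"
    by (simp only:)
  hence head: "(\<Sum>n<3. b n * X ^ n) = 1 + X / 4 + X\<^sup>2 / 64"
    by simp
  have sums: "(\<lambda>n. b n * X ^ n) sums circle_mean_norm z"
    using circle_mean_norm_sums[OF assms] by (simp add: b_def X_def)
  have "(\<Sum>n<3. b n * X ^ n) \<le> circle_mean_norm z"
    using sums b0 X by (intro sum_le_suminf[of "\<lambda>n. b n * X ^ n" "{..<3}", unfolded sums_unique[OF sums, symmetric]])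
      (auto simp: sums_iff)
  thus "1 + (cmod z)\<^sup>2 / 4 + (cmod z) ^ 4 / 64 \<le> circle_mean_norm z"
    unfolding head by (simp add: X_def flip: power_mult)
  have "(\<Sum>n<N. b n * X ^ n) \<le> 1 + X / 4 + X\<^sup>2 / 64 + X ^ 3 / 128" if "N \<ge> 3" for N
  proof -
    obtain M where M: "N = M + 3" using \<open>N \<ge> 3\<close> by (metis le_add_diff_inverse2)
    have "(\<Sum>n<N. b n * X ^ n) = (\<Sum>n<3. b n * X ^ n) + (\<Sum>n<M. b (n + 3) * X ^ (n + 3))"
      unfolding M by (induction M) (simp_all add: eval_nat_numeral)
    also have "(\<Sum>n<M. b (n + 3) * X ^ (n + 3)) \<le> (\<Sum>n<M. b (n + 3) * X ^ 3)"
      using b0 X by (intro sum_mono mult_left_mono power_decreasing) auto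
    also have "\<dots> = (\<Sum>n<M. b (n + 3)) * X ^ 3" by (simp add: sum_distrib_right)
    also have "(\<Sum>n<M. b (n + 3)) \<le> 1 / 128 - (real M + 4) / 2 * b (M + 3)"
      unfolding b_def by (rule sum_gbinomial_half_square_le)
    also have "\<dots> \<le> 1 / 128" using b0[of "M + 3"] by simp
    finally show ?thesis unfolding head using X by (simp add: mult_right_mono)
  qed
  hence "circle_mean_norm z \<le> 1 + X / 4 + X\<^sup>2 / 64 + X ^ 3 / 128"
    using sums unfolding sums_def by (intro LIMSEQ_le_const2) auto
  thus "circle_mean_norm z \<le> 1 + (cmod z)\<^sup>2 / 4 + (cmod z) ^ 4 / 64 + (cmod z) ^ 6 / 128"
    by (simp add: X_def flip: power_mult)
qed

lemma continuous_on_circle_mean_norm: "continuous_on UNIV circle_mean_norm"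
proof -
  have "continuous_on UNIV (\<lambda>z. integral (cbox 0 (2 * pi)) (\<lambda>t. cmod (1 + z * exp (\<i> * complex_of_real t))))"
    by (intro integral_continuous_on_param) (auto simp: case_prod_unfold intro!: continuous_intros)
  thus ?thesis
    unfolding circle_mean_norm_def by (auto intro!: continuous_intros)
qed

text \<open>The binomial series was used only inside the disc; continuity along
  \<open>s n * z\<close> adds the boundary, needed for entries of equal modulus.\<close>

lemma circle_mean_norm_bounds:
  assumes "cmod z \<le> 1"
  shows "1 + (cmod z)\<^sup>2 / 4 + (cmod z) ^ 4 / 64 \<le> circle_mean_norm z"
    and "circle_mean_norm z \<le> 1 + (cmod z)\<^sup>2 / 4 + (cmod z) ^ 4 / 64 + (cmod z) ^ 6 / 128"
proof -
  define s where "s n = real n / real (Suc n)" for n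
  let ?z = "\<lambda>n. complex_of_real (s n) * z"
  have "s \<longlonglongrightarrow> 1"
    unfolding s_def by (rule LIMSEQ_n_over_Suc_n)
  hence "?z \<longlonglongrightarrow> complex_of_real 1 * z"
    by (intro tendsto_intros)
  hence z: "?z \<longlonglongrightarrow> z" by simp
  have lt: "cmod (?z n) < 1" for n
  proof -
    have "cmod (?z n) \<le> s n"
      unfolding norm_mult norm_of_real using assms by (simp add: s_def divide_right_mono mult_left_le)
    also have "s n < 1" by (simp add: s_def)
    finally show ?thesis .
  qed
  have lim: "(\<lambda>n. circle_mean_norm (?z n)) \<longlonglongrightarrow> circle_mean_norm z"
    using continuous_on_circle_mean_norm z by (rule continuous_on_tendsto_compose) auto
  show "1 + (cmod z)\<^sup>2 / 4 + (cmod z) ^ 4 / 64 \<le> circle_mean_norm z"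
    by (rule LIMSEQ_le[OF _ lim, of "\<lambda>n. 1 + (cmod (?z n))\<^sup>2 / 4 + (cmod (?z n)) ^ 4 / 64"])
       (use lt circle_mean_norm_bounds_open_disc(1) in \<open>auto intro!: tendsto_intros z\<close>)
  show "circle_mean_norm z \<le> 1 + (cmod z)\<^sup>2 / 4 + (cmod z) ^ 4 / 64 + (cmod z) ^ 6 / 128"
    by (rule LIMSEQ_le[OF lim, of "\<lambda>n. 1 + (cmod (?z n))\<^sup>2 / 4 + (cmod (?z n)) ^ 4 / 64 + (cmod (?z n)) ^ 6 / 128"])
       (use lt circle_mean_norm_bounds_open_disc(2) in \<open>auto intro!: tendsto_intros z\<close>)
qed

section \<open>Polynomial comparisons on \<open>[0, 1]\<close> and Hoelder's inequality\<close>

fun psums_nonneg :: "real \<Rightarrow> real list \<Rightarrow> bool" where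
  "psums_nonneg s [] = (0 \<le> s)"
| "psums_nonneg s (c # cs) = (0 \<le> s + c \<and> psums_nonneg (s + c) cs)"

text \<open>Abel summation: a polynomial is nonnegative on \<open>[0, 1]\<close> as soon as all partial sums of its
  coefficients are, a condition that the simplifier can check on large explicit polynomials.\<close>

lemma psums_nonneg_imp_poly_nonneg:
  assumes "psums_nonneg s cs" "0 \<le> w" "w \<le> 1"
  shows "0 \<le> s + poly (Poly cs) w"
  using assms(1)
proof (induction s cs rule: psums_nonneg.induct)
  case (2 s c cs)
  have "0 \<le> (1 - w) * (s + c) + w * (s + c + poly (Poly cs) w)"
    using 2 assms(2,3) by (intro add_nonneg_nonneg[OF mult_nonneg_nonneg mult_nonneg_nonneg]) auto
  thus ?case by (simp add: algebra_simps)
qed simp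

lemma poly_nonneg_if_psums_nonneg:
  assumes "psums_nonneg 0 (coeffs p)" "0 \<le> w" "w \<le> 1"
  shows "0 \<le> poly p w"
  using psums_nonneg_imp_poly_nonneg[OF assms] by simp

lemma quartic_le_radicand:
  fixes w :: real
  assumes w: "0 \<le> w" "w \<le> 1" and X: "X = w * (2 + w)\<^sup>2 / (1 + 2 * w)\<^sup>2"
  shows "((1 + 2 * w) * (1 + X / 4 + X ^ 2 / 64 + X ^ 3 / 128)) ^ 4 \<le> (1 + 4 * w + w\<^sup>2) ^ 3"
proof -
  define d n :: "real poly" where "d = [:1, 2:] ^ 2" and "n = [:0, 1:] * [:2, 1:] ^ 2"
  \<comment> \<open>With \<open>X = n / d\<close>, \<open>u\<close> is \<open>128 * d ^ 3\<close>
    times the cubic bound. Since \<open>d ^ 2\<close> is the fourth power of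
    \<open>1 + 2 * w\<close>, a factor \<open>d ^ 10\<close> can be cancelled from the
    comparison.\<close>
  define u where "u = smult 128 (d ^ 3) + smult 32 (n * d ^ 2) + smult 2 (n ^ 2 * d) + n ^ 3"
  define q where "q = smult (128 ^ 4) (d ^ 10 * [:1, 4, 1:] ^ 3) - u ^ 4"
  have "psums_nonneg 0 (coeffs q)"
    unfolding q_def u_def d_def n_def by (simp add: eval_nat_numeral)
  hence "0 \<le> poly q w"
    using w by (rule poly_nonneg_if_psums_nonneg)
  moreover have d: "poly d w = (1 + 2 * w)\<^sup>2" "poly d w > 0"
    using w by (simp_all add: d_def poly_power algebra_simps)
  moreover have "X = poly n w / poly d w"
    by (simp add: X n_def d_def poly_power algebra_simps)
  hence "poly n w = X * poly d w"
    using d(2) by simp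
  hence "poly u w = 128 * poly d w ^ 3 * (1 + X / 4 + X ^ 2 / 64 + X ^ 3 / 128)"
    by (simp add: u_def poly_power algebra_simps eval_nat_numeral)
  moreover have "poly [:1, 4, 1:] w = 1 + 4 * w + w\<^sup>2"
    by (simp add: algebra_simps power2_eq_square)
  ultimately have "(128 ^ 4 * poly d w ^ 10) * ((poly d w)\<^sup>2 * (1 + X / 4 + X ^ 2 / 64 + X ^ 3 / 128) ^ 4) \<le> (128 ^ 4 * poly d w ^ 10) * (1 + 4 * w + w\<^sup>2) ^ 3"
    by (simp only: q_def poly_diff poly_smult poly_mult poly_power)
       (simp add: power_mult_distrib mult_ac flip: power_mult power_add)
  hence "(poly d w)\<^sup>2 * (1 + X / 4 + X ^ 2 / 64 + X ^ 3 / 128) ^ 4 \<le> (1 + 4 * w + w\<^sup>2) ^ 3"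
    by (rule mult_left_le_imp_le) (use d(2) in simp)
  thus ?thesis
    unfolding d(1) power_mult_distrib by (simp flip: power_mult)
qed

text \<open>This is the source of the constant 1.01. There is little room at \<open>w = 1\<close>,
  where the sides are 216 and about 216.27.\<close>

lemma radicand_le_quartic:
  fixes w :: real
  assumes w: "0 \<le> w" "w \<le> 1" and X: "X = w * (2 + w)\<^sup>2 / (1 + 2 * w)\<^sup>2"
  shows "(1 + 4 * w + w\<^sup>2) ^ 3 \<le> (1.01 * ((1 + 2 * w) * (1 + X / 4 + X ^ 2 / 64))) ^ 4"
proof -
  define d n :: "real poly" where "d = [:1, 2:] ^ 2" and "n = [:0, 1:] * [:2, 1:] ^ 2"
  define u where "u = smult 64 (d ^ 2) + smult 16 (n * d) + n ^ 2"
  \<comment> \<open>Here \<open>u\<close> is \<open>64 * d ^ 2\<close> times the quadratic bound,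
    and 6400 combines this 64 with the denominator of 101/100.\<close>
  define q where "q = smult (101 ^ 4) (u ^ 4) - smult (6400 ^ 4) (d ^ 6 * [:1, 4, 1:] ^ 3)"
  have "psums_nonneg 0 (coeffs q)"
    unfolding q_def u_def d_def n_def by (simp add: eval_nat_numeral)
  hence "0 \<le> poly q w"
    using w by (rule poly_nonneg_if_psums_nonneg)
  moreover have d: "poly d w = (1 + 2 * w)\<^sup>2" "poly d w > 0"
    using w by (simp_all add: d_def poly_power algebra_simps)
  moreover have "X = poly n w / poly d w"
    by (simp add: X n_def d_def poly_power algebra_simps)
  hence "poly n w = X * poly d w"
    using d(2) by simp
  hence "poly u w = 64 * poly d w ^ 2 * (1 + X / 4 + X ^ 2 / 64)"
    by (simp add: u_def poly_power algebra_simps eval_nat_numeral)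
  moreover have "poly [:1, 4, 1:] w = 1 + 4 * w + w\<^sup>2"
    by (simp add: algebra_simps power2_eq_square)
  ultimately have "(6400 ^ 4 * poly d w ^ 6) * (1 + 4 * w + w\<^sup>2) ^ 3 \<le> (6400 ^ 4 * poly d w ^ 6) * (1.01 ^ 4 * ((poly d w)\<^sup>2 * (1 + X / 4 + X ^ 2 / 64) ^ 4))"
    by (simp only: q_def poly_diff poly_smult poly_mult poly_power)
       (simp add: power_mult_distrib power_divide mult_ac flip: power_mult power_add)
  hence "(1 + 4 * w + w\<^sup>2) ^ 3 \<le> 1.01 ^ 4 * ((poly d w)\<^sup>2 * (1 + X / 4 + X ^ 2 / 64) ^ 4)"
    by (rule mult_left_le_imp_le) (use d(2) in simp)
  thus ?thesis
    unfolding d(1) power_mult_distrib by (simp flip: power_mult)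
qed

text \<open>Two applications of the Cauchy-Schwarz inequality: \<open>T\<close> pairs \<open>f\<^sup>2\<close> with \<open>\<xi>f\<close>, and \<open>S\<close> is the squared
  \<open>L\<^sup>2\<close> norm of \<open>\<xi>f\<close>, where \<open>\<xi> = p + q e\<^sup>i\<^sup>t\<close> and \<open>f = 1 + y e\<^sup>i\<^sup>t\<close>.\<close>

lemma hoelder_4_real:
  fixes p q y :: real
  shows "(p * (1 + 2 * y\<^sup>2) + q * (y * (2 + y\<^sup>2))) ^ 4
    \<le> (p ^ 4 + 4 * p\<^sup>2 * q\<^sup>2 + q ^ 4) * (1 + 4 * y\<^sup>2 + y ^ 4) ^ 3"
proof -
  define T where "T = p * (1 + 2 * y\<^sup>2) + q * (y * (2 + y\<^sup>2))"
  define S where "S = p\<^sup>2 + (p * y + q)\<^sup>2 + (q * y)\<^sup>2"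
  define F where "F = 1 + 4 * y\<^sup>2 + y ^ 4"
  define M where "M = p ^ 4 + 4 * p\<^sup>2 * q\<^sup>2 + q ^ 4"
  \<comment> \<open>Lagrange's identity for the coefficient vectors \<open>(1, 2y, y^2)\<close> of
    \<open>f^2\<close> and \<open>(p, py + q, qy)\<close> of \<open>\<xi>f\<close>.\<close>
  have "F * S - T\<^sup>2 = (p * y + q - 2 * y * p)\<^sup>2 + (q * y - y\<^sup>2 * p)\<^sup>2
      + (2 * y * (q * y) - y\<^sup>2 * (p * y + q))\<^sup>2"
    unfolding F_def S_def T_def by algebra
  hence T: "T\<^sup>2 \<le> F * S" by (smt (verit) zero_le_power2)
  \<comment> \<open>Lagrange's identity for the Fourier coefficients
    \<open>(pq, p^2 + q^2, pq)\<close> and \<open>(y, 1 + y^2, y)\<close> of the squared moduli of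
    \<open>\<xi>\<close> and \<open>f\<close>.\<close>
  have "M * F - S\<^sup>2 = 2 * ((p\<^sup>2 + q\<^sup>2) * y - p * q * (1 + y\<^sup>2))\<^sup>2"
    unfolding F_def S_def M_def by algebra
  hence S: "S\<^sup>2 \<le> M * F" by (smt (verit) zero_le_power2)
  have "T ^ 4 = (T\<^sup>2)\<^sup>2" by simp
  also have "\<dots> \<le> (F * S)\<^sup>2" using T by (intro power_mono) auto
  also have "\<dots> = F\<^sup>2 * S\<^sup>2" by (simp add: power_mult_distrib)
  also have "\<dots> \<le> F\<^sup>2 * (M * F)" using S by (intro mult_left_mono) auto
  also have "\<dots> = M * F ^ 3" by (simp add: eval_nat_numeral)
  finally show ?thesis unfolding T_def F_def M_def .
qed

section \<open>Symmetries of the \<open>H^1\<close> norm and the \<open>H^4\<close> formula\<close>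

lemma hardy_norm_1_eq:
  "hardy_norm 1 (a, b) = 1 / (2 * pi) * integral {0..2 * pi} (\<lambda>t. cmod (a + b * exp (\<i> * complex_of_real t)))"
  by (simp add: hardy_norm_def integral_nonneg integrable_continuous_real continuous_intros)

lemma hardy_norm_nonneg: "0 \<le> hardy_norm p a"
  by (simp add: hardy_norm_def)

lemma hardy_norm_1_factor:
  assumes "a \<noteq> 0"
  shows "hardy_norm 1 (a, b) = cmod a * circle_mean_norm (b / a)"
proof -
  have "cmod (a + b * exp (\<i> * complex_of_real t)) = cmod a * cmod (1 + b / a * exp (\<i> * complex_of_real t))" for t
  proof -
    have "a + b * exp (\<i> * complex_of_real t) = a * (1 + b / a * exp (\<i> * complex_of_real t))"
      using assms by (simp add: distrib_left)
    thus ?thesis by (simp only: norm_mult)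
  qed
  thus ?thesis
    by (simp add: hardy_norm_1_eq circle_mean_norm_def)
qed

lemma hardy_norm_1_scale: "hardy_norm 1 (c * a, c * b) = cmod c * hardy_norm 1 (a, b)"
proof -
  have "cmod (c * a + c * b * exp (\<i> * complex_of_real t)) = cmod c * cmod (a + b * exp (\<i> * complex_of_real t))" for t
    by (simp add: algebra_simps flip: norm_mult)
  thus ?thesis
    by (simp add: hardy_norm_1_eq)
qed

text \<open>Conjugation and multiplication by the unimodular \<open>e^{it}\<close> preserve the
  modulus. This lets the entry of larger modulus be placed first.\<close>

lemma hardy_norm_1_swap: "hardy_norm 1 (a, b) = hardy_norm 1 (cnj b, cnj a)"
proof -
  have "cmod (a + b * exp (\<i> * complex_of_real t)) = cmod (cnj b + cnj a * exp (\<i> * complex_of_real t))" for t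
  proof -
    let ?e = "exp (\<i> * complex_of_real t)"
    have "cnj (a + b * ?e) * ?e = cnj b * (cnj ?e * ?e) + cnj a * ?e"
      by (simp add: algebra_simps)
    also have "cnj ?e * ?e = 1" by (simp add: exp_cnj flip: exp_add)
    finally have "cnj b + cnj a * ?e = cnj (a + b * ?e) * ?e" by simp
    thus ?thesis by (simp only: norm_mult complex_mod_cnj norm_exp_i_times mult_1_right)
  qed
  thus ?thesis by (simp add: hardy_norm_1_eq)
qed

text \<open>Parseval for \<open>f^2\<close>, whose coefficients are \<open>a^2\<close>,
  \<open>2ab\<close>, \<open>b^2\<close>.\<close>

lemma hardy_norm_4_power:
  "hardy_norm 4 (a, b) ^ 4 = cmod a ^ 4 + 4 * (cmod a)\<^sup>2 * (cmod b)\<^sup>2 + cmod b ^ 4"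
proof -
  define c where "c n = [a\<^sup>2, 2 * a * b, b\<^sup>2] ! n" for n
  have "cmod (a + b * exp (\<i> * complex_of_real t)) powr 4 =
      (cmod (\<Sum>n<3. c n * exp (\<i> * complex_of_real t) ^ n))\<^sup>2" for t
  proof -
    have "(\<Sum>n<3. c n * exp (\<i> * complex_of_real t) ^ n) = (a + b * exp (\<i> * complex_of_real t))\<^sup>2"
      by (simp add: c_def eval_nat_numeral algebra_simps)
    thus ?thesis by (simp add: norm_power)
  qed
  moreover have "(\<Sum>n<3. (cmod (c n))\<^sup>2) = cmod a ^ 4 + 4 * (cmod a)\<^sup>2 * (cmod b)\<^sup>2 + cmod b ^ 4"
    by (simp add: c_def numeral_3_eq_3 norm_mult norm_power power_mult_distrib)
  ultimately have "hardy_norm 4 (a, b) =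
      (cmod a ^ 4 + 4 * (cmod a)\<^sup>2 * (cmod b)\<^sup>2 + cmod b ^ 4) powr (1 / 4)"
    by (simp add: hardy_norm_def integral_unique[OF parseval_sum])
  thus ?thesis
    by (simp add: powr_powr flip: powr_numeral)
qed

section \<open>The two duality estimates\<close>

lemma hardy_norm_1_extremal_le:
  "hardy_norm 1 (a * of_real ((cmod a)\<^sup>2 + 2 * (cmod b)\<^sup>2), b * of_real (2 * (cmod a)\<^sup>2 + (cmod b)\<^sup>2))
    \<le> hardy_norm 4 (a, b) ^ 3" (is "?H a b \<le> _")
proof -
  have main: "?H a b ^ 4 \<le> (cmod a ^ 4 + 4 * (cmod a)\<^sup>2 * (cmod b)\<^sup>2 + cmod b ^ 4) ^ 3"
    if ba: "cmod b \<le> cmod a" for a b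
  proof (cases "a = 0")
    case True
    thus ?thesis using ba by (simp add: hardy_norm_1_eq)
  next
    case False
    define r where "r = cmod a"
    define y where "y = cmod b / cmod a"
    define w where "w = y\<^sup>2"
    have r: "r > 0" and y: "0 \<le> y" "y \<le> 1" using False ba by (simp_all add: r_def y_def)
    hence w: "0 \<le> w" "w \<le> 1" by (simp_all add: w_def power_le_one)
    have b: "cmod b = r * y" using r by (simp add: y_def r_def)
    define c d where "c = a * of_real ((cmod a)\<^sup>2 + 2 * (cmod b)\<^sup>2)"
      and "d = b * of_real (2 * (cmod a)\<^sup>2 + (cmod b)\<^sup>2)"
    have c: "cmod c = r ^ 3 * (1 + 2 * w)"
      unfolding c_def norm_mult norm_of_real b r_def[symmetric] w_def using y r
      by (simp add: algebra_simps eval_nat_numeral)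
    have d: "cmod d = r ^ 3 * (y * (2 + w))"
      unfolding d_def norm_mult norm_of_real b r_def[symmetric] w_def using y r
      by (simp add: algebra_simps eval_nat_numeral)
    have c0: "c \<noteq> 0" using c r w by force
    have z: "cmod (d / c) = y * (2 + w) / (1 + 2 * w)"
      using r by (simp add: norm_divide c d)
    \<comment> \<open>This factorization shows \<open>cmod d \<le> cmod c\<close>, so the ratio lies
      in the closed disc where the series bounds hold.\<close>
    have "0 \<le> (1 - y) * ((1 - y)\<^sup>2 + y)" using y by simp
    also have "\<dots> = (1 + 2 * w) - y * (2 + w)"
      by (simp add: w_def algebra_simps eval_nat_numeral)
    finally have z1: "cmod (d / c) \<le> 1" using z w by simp
    define X where "X = (cmod (d / c))\<^sup>2"
    have X: "X = w * (2 + w)\<^sup>2 / (1 + 2 * w)\<^sup>2"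
      unfolding X_def z by (simp add: w_def power_divide power_mult_distrib)
    have "hardy_norm 1 (c, d) \<le> cmod c * (1 + X / 4 + X ^ 2 / 64 + X ^ 3 / 128)"
      unfolding hardy_norm_1_factor[OF c0] using circle_mean_norm_bounds(2)[OF z1]
      by (intro mult_left_mono) (simp_all add: X_def flip: power_mult)
    hence "hardy_norm 1 (c, d) ^ 4 \<le> (r ^ 3 * ((1 + 2 * w) * (1 + X / 4 + X ^ 2 / 64 + X ^ 3 / 128))) ^ 4"
      by (intro power_mono hardy_norm_nonneg) (simp add: c mult.assoc)
    also have "\<dots> \<le> r ^ 12 * (1 + 4 * w + w\<^sup>2) ^ 3"
      unfolding power_mult_distrib[of "r ^ 3"] using quartic_le_radicand[OF w X] r
      by (intro mult_mono) (simp_all flip: power_mult)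
    also have "\<dots> = (r ^ 4 * (1 + 4 * w + w\<^sup>2)) ^ 3"
      unfolding power_mult_distrib by (simp flip: power_mult)
    also have "r ^ 4 * (1 + 4 * w + w\<^sup>2) = cmod a ^ 4 + 4 * (cmod a)\<^sup>2 * (cmod b)\<^sup>2 + cmod b ^ 4"
      unfolding b r_def[symmetric] w_def by (simp add: algebra_simps eval_nat_numeral)
    finally show ?thesis by (simp only: c_def d_def)
  qed
  have "?H a b ^ 4 \<le> (cmod a ^ 4 + 4 * (cmod a)\<^sup>2 * (cmod b)\<^sup>2 + cmod b ^ 4) ^ 3"
  proof (cases "cmod b \<le> cmod a")
    case False
    have "?H a b = ?H (cnj b) (cnj a)"
      by (subst hardy_norm_1_swap) (simp add: add.commute)
    with main[of "cnj a" "cnj b"] False show ?thesis by (simp add: ac_simps)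
  qed (rule main)
  also have "\<dots> = (hardy_norm 4 (a, b) ^ 3) ^ 4"
    unfolding hardy_norm_4_power[symmetric] by (simp flip: power_mult)
  finally show ?thesis
    by (rule power_le_imp_le_base[of _ 3, simplified]) (simp add: hardy_norm_nonneg)
qed

text \<open>Hoelder's inequality is applied with the \<open>y\<close> whose extremal pair has ratio
  \<open>x\<close>; the lower series bound then recovers the \<open>H^1\<close> norm at a cost of
  1.01.\<close>

lemma weighted_sum_le_hardy_norms:
  fixes p q N :: real
  assumes dc: "cmod d \<le> cmod c" and N: "0 \<le> N" "N ^ 4 = p ^ 4 + 4 * p\<^sup>2 * q\<^sup>2 + q ^ 4"
  shows "p * cmod c + q * cmod d \<le> 1.01 * N * hardy_norm 1 (c, d)"
proof (cases "c = 0")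
  case True
  thus ?thesis using dc by (simp add: hardy_norm_1_eq)
next
  case False
  define x where "x = cmod (d / c)"
  have x: "0 \<le> x" "x \<le> 1" using dc False by (simp_all add: x_def norm_divide)
  \<comment> \<open>The expression is \<open>-x\<close> at \<open>y = 0\<close> and
    \<open>3 - 3x\<close> at \<open>y = 1\<close>.\<close>
  have "\<exists>y\<ge>0. y \<le> 1 \<and> y * (2 + y\<^sup>2) - x * (1 + 2 * y\<^sup>2) = 0"
    by (rule IVT') (use x in \<open>auto intro!: continuous_intros\<close>)
  then obtain y where y: "0 \<le> y" "y \<le> 1" "y * (2 + y\<^sup>2) = x * (1 + 2 * y\<^sup>2)" by auto
  define w where "w = y\<^sup>2"
  have w: "0 \<le> w" "w \<le> 1" using y by (simp_all add: w_def power_le_one)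
  define X where "X = x\<^sup>2"
  have xw: "x = y * (2 + w) / (1 + 2 * w)" using y(3) w unfolding w_def[symmetric] by (subst eq_divide_eq) auto
  have X: "X = w * (2 + w)\<^sup>2 / (1 + 2 * w)\<^sup>2"
    unfolding X_def xw by (simp add: w_def power_divide power_mult_distrib)
  define L where "L = 1 + X / 4 + X ^ 2 / 64"
  have L: "L \<ge> 0" by (simp add: L_def X_def)
  have "((1 + 2 * w) * (p + q * x)) ^ 4 = (p * (1 + 2 * y\<^sup>2) + q * (y * (2 + y\<^sup>2))) ^ 4"
    unfolding y(3) w_def by (simp add: algebra_simps)
  also have "\<dots> \<le> N ^ 4 * (1 + 4 * w + w\<^sup>2) ^ 3"
    using hoelder_4_real[of p y q] by (simp add: N(2) w_def flip: power_mult)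
  also have "\<dots> \<le> N ^ 4 * (1.01 * ((1 + 2 * w) * L)) ^ 4"
    unfolding L_def by (intro mult_left_mono radicand_le_quartic[OF w X]) simp
  also have "\<dots> = ((1 + 2 * w) * (1.01 * N * L)) ^ 4"
    by (simp add: power_mult_distrib power_divide)
  finally have "(1 + 2 * w) * (p + q * x) \<le> (1 + 2 * w) * (1.01 * N * L)"
    by (rule power_le_imp_le_base[of _ 3, simplified]) (use w N L in simp)
  hence "p + q * x \<le> 1.01 * N * L"
    using w by (simp add: mult_le_cancel_left)
  also have "\<dots> \<le> 1.01 * N * circle_mean_norm (d / c)"
    using circle_mean_norm_bounds(1)[of "d / c"] x N(1)
    by (intro mult_left_mono) (simp_all add: L_def X_def x_def flip: power_mult)
  finally have "cmod c * (p + q * x) \<le> cmod c * (1.01 * N * circle_mean_norm (d / c))"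
    by (intro mult_left_mono) auto
  thus ?thesis
    using False by (simp add: hardy_norm_1_factor x_def norm_divide algebra_simps)
qed

lemma cmod_cpairing_le:
  "cmod (cpairing \<xi> \<eta>) \<le> 1.01 * hardy_norm 4 \<xi> * hardy_norm 1 \<eta>"
proof -
  obtain a b c d where \<xi>: "\<xi> = (a, b)" and \<eta>: "\<eta> = (c, d)" by (metis surj_pair)
  have "cmod (cpairing \<xi> \<eta>) \<le> cmod a * cmod c + cmod b * cmod d"
    unfolding cpairing_def \<xi> \<eta> by (rule order_trans[OF norm_triangle_ineq]) (simp add: norm_mult)
  also have "\<dots> \<le> 1.01 * hardy_norm 4 \<xi> * hardy_norm 1 \<eta>"
  proof (cases "cmod d \<le> cmod c")
    case True
    thus ?thesis
      unfolding \<xi> \<eta> by (intro weighted_sum_le_hardy_norms) (simp_all add: hardy_norm_nonneg hardy_norm_4_power)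
  next
    case False
    hence "cmod b * cmod (cnj d) + cmod a * cmod (cnj c)
        \<le> 1.01 * hardy_norm 4 (a, b) * hardy_norm 1 (cnj d, cnj c)"
      by (intro weighted_sum_le_hardy_norms) (simp_all add: hardy_norm_nonneg hardy_norm_4_power)
    thus ?thesis
      unfolding \<xi> \<eta> hardy_norm_1_swap[of c d] by simp
  qed
  finally show ?thesis .
qed

theorem theorem1p2:
  fixes \<xi> :: "complex \<times> complex"
  assumes "\<xi> \<noteq> (0, 0)"
  shows "1 \<le> hardy_dual_norm \<xi> / hardy_norm 4 \<xi> \<and>
         hardy_dual_norm \<xi> / hardy_norm 4 \<xi> \<le> 1.01"
proof -
  let ?S = "{cmod (cpairing \<xi> \<eta>) |\<eta>. hardy_norm 1 \<eta> \<le> 1}"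
  obtain a b where \<xi>: "\<xi> = (a, b)" by (metis surj_pair)
  define N where "N = hardy_norm 4 \<xi>"
  have N4: "N ^ 4 = cmod a ^ 4 + 4 * (cmod a)\<^sup>2 * (cmod b)\<^sup>2 + cmod b ^ 4"
    unfolding N_def \<xi> by (rule hardy_norm_4_power)
  have "N ^ 4 > 0"
    using assms unfolding N4 \<xi> by (cases "a = 0") (auto simp: add_pos_nonneg)
  hence N: "N > 0"
    using hardy_norm_nonneg[of 4 \<xi>] unfolding N_def by (cases "hardy_norm 4 \<xi> = 0") auto
  have le: "s \<le> 1.01 * N" if "s \<in> ?S" for s
  proof -
    from that obtain \<eta> where \<eta>: "s = cmod (cpairing \<xi> \<eta>)" "hardy_norm 1 \<eta> \<le> 1" by auto
    have "s \<le> 1.01 * N * hardy_norm 1 \<eta>" unfolding \<eta>(1) N_def by (rule cmod_cpairing_le)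
    also have "\<dots> \<le> 1.01 * N * 1" using \<eta>(2) N by (intro mult_left_mono) auto
    finally show ?thesis by simp
  qed
  define c d where "c = a * of_real ((cmod a)\<^sup>2 + 2 * (cmod b)\<^sup>2)"
    and "d = b * of_real (2 * (cmod a)\<^sup>2 + (cmod b)\<^sup>2)"
  \<comment> \<open>The extremal pair has \<open>H^1\<close> norm at most \<open>N ^ 3\<close> and
    pairs with \<open>\<xi>\<close> to \<open>N ^ 4\<close>; this scaling makes it admissible with
    pairing \<open>N\<close>.\<close>
  define k where "k = complex_of_real (1 / N ^ 3)"
  have k: "cmod k = 1 / N ^ 3" using N by (simp add: k_def norm_divide norm_power)
  have "hardy_norm 1 (k * c, k * d) \<le> 1"
    using hardy_norm_1_extremal_le[of a b] N
    by (simp add: hardy_norm_1_scale k c_def d_def N_def \<xi>)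
  moreover have "cmod (cpairing \<xi> (k * c, k * d)) = N"
  proof -
    have "cpairing \<xi> (k * c, k * d) = complex_of_real (1 / N ^ 3) *
        ((a * cnj a) * of_real ((cmod a)\<^sup>2 + 2 * (cmod b)\<^sup>2) + (b * cnj b) * of_real (2 * (cmod a)\<^sup>2 + (cmod b)\<^sup>2))"
      by (simp add: cpairing_def \<xi> c_def d_def k_def algebra_simps)
    also have "\<dots> = complex_of_real (1 / N ^ 3 * N ^ 4)"
      unfolding N4 complex_norm_square[symmetric] by (simp add: algebra_simps eval_nat_numeral)
    also have "1 / N ^ 3 * N ^ 4 = N" using N by (simp add: eval_nat_numeral)
    finally show ?thesis using N by simp
  qed
  ultimately have N_in: "N \<in> ?S" by force
  have "N \<le> hardy_dual_norm \<xi>"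
    unfolding hardy_dual_norm_def using N_in le by (intro cSup_upper bdd_aboveI[of ?S "1.01 * N"])
  moreover have "hardy_dual_norm \<xi> \<le> 1.01 * N"
    unfolding hardy_dual_norm_def using N_in le by (intro cSup_least) auto
  ultimately show ?thesis
    using N unfolding N_def[symmetric] by (simp add: field_simps)
qed

end
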